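(* Let $G$ be an SCT graph with $V$ vertices. All standard solutions of the homogeneous Kuramoto system on $G$ lie on the Segre variety $\Sigma$ of $\mathbb{P}^1\times\mathbb{P}^{V-1}$: if $(\theta_0^*,\ldots,\theta_{V-1}^* )$ is a standard solution and $x_i=\sin(\theta_i^* )$, $y_i=\cos(\theta_i^* )$, then the point $(x_0,\ldots,x_{V-1},y_0,\ldots,y_{V-1})$ is a zero of every polynomial in $I_\Sigma$.
   Context: An SCT graph is a finite simple connected graph (no loops or multiple edges) in which every vertex has degree at least $2$. Label the vertices $v_0,\ldots,v_{V-1}$ and let $G_i$ be the set of vertices adjacent to $v_i$. The homogeneous Kuramoto system on $G$ is $\dot\theta_i=\sum_{v_j\in G_i}\sin(\theta_j-\theta_i)$. A solution (equilibrium) is a point $(\theta_0^*,\ldots,\theta_{V-1}^* )\in\mathbb{R}^V$ with $\sum_{v_j\in G_i}\sin(\theta_j^*-\theta_i^* )=0$ for all $i$; it is standard if $\theta_i^*-\theta_j^*\in\{0,\pi\}$ modulo $2\pi$ for all $i,j$. The Segre variety $\Sigma\subset\mathbb{P}^{2V-1}$ is the image of the Segre embedding of $\mathbb{P}^1\times\mathbb{P}^{V-1}$, and its ideal $I_\Sigma$ is generated by the $2\times 2$ minors of $$\begin{pmatrix}x_0&x_1&\cdots&x_{V-1}\\ y_0&y_1&\cdots&y_{V-1}\end{pmatrix}.$$ *)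

theory Defs
  imports
    Complex_Main
    "HOL-Library.Poly_Mapping"
    "HOL-Library.Real_Mod"
    "Graph_Theory.Graph_Theory"
begin

section \<open>SCT graphs and the homogeneous Kuramoto system\<close>

text \<open>
  The locale \<^locale>\<open>graph\<close> describes finite simple undirected graphs, encoded as symmetric digraphs
  without loops and multiple arcs: an undirected edge is a pair of opposite arcs.
\<close>

definition neighbours :: "('a, 'e) pre_digraph \<Rightarrow> 'a \<Rightarrow> 'a set" where
  "neighbours G u = {w. u \<rightarrow>\<^bsub>G\<^esub> w}"

definition sct_graph :: "('a, 'e) pre_digraph \<Rightarrow> bool" where
  "sct_graph G \<longleftrightarrow> graph G \<and> Digraph_Component.connected G \<and>
     (\<forall>u\<in>verts G. 2 \<le> card (neighbours G u))"

text \<open>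
  The vertices are labelled by a finite index type \<open>'n\<close>, which plays the role of
  \<open>{0, \<dots>, V - 1}\<close>; thus \<open>V\<close> is the cardinality of \<open>'n\<close>, and a point of
  \<open>V\<close>-dimensional real space is a function \<open>\<theta> :: 'n \<Rightarrow> real\<close>.
\<close>

definition vertex_labelling :: "('a, 'e) pre_digraph \<Rightarrow> ('n::finite \<Rightarrow> 'a) \<Rightarrow> bool" where
  "vertex_labelling G v \<longleftrightarrow> bij_betw v UNIV (verts G)"

text \<open>The right-hand side of the Kuramoto differential equations:\<close>

definition kuramoto_field ::
    "('a, 'e) pre_digraph \<Rightarrow> ('n::finite \<Rightarrow> 'a) \<Rightarrow> ('n \<Rightarrow> real) \<Rightarrow> 'n \<Rightarrow> real" where
  "kuramoto_field G v \<theta> i = (\<Sum>j | v j \<in> neighbours G (v i). sin (\<theta> j - \<theta> i))"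

definition kuramoto_solution ::
    "('a, 'e) pre_digraph \<Rightarrow> ('n::finite \<Rightarrow> 'a) \<Rightarrow> ('n \<Rightarrow> real) \<Rightarrow> bool" where
  "kuramoto_solution G v \<theta> \<longleftrightarrow> (\<forall>i. kuramoto_field G v \<theta> i = 0)"

definition standard_solution ::
    "('a, 'e) pre_digraph \<Rightarrow> ('n::finite \<Rightarrow> 'a) \<Rightarrow> ('n \<Rightarrow> real) \<Rightarrow> bool" where
  "standard_solution G v \<theta> \<longleftrightarrow> kuramoto_solution G v \<theta> \<and>
     (\<forall>i j. [\<theta> i - \<theta> j = 0] (rmod (2 * pi)) \<or> [\<theta> i - \<theta> j = pi] (rmod (2 * pi)))"


section \<open>Projective space and the Segre variety\<close>

text \<open>
  The homogeneous coordinates of a projective space are indexed by a finite type \<open>'i\<close>, so the space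
  has dimension one less than the cardinality of \<open>'i\<close>.  Its points are the classes of nonzero
  vectors under nonzero scaling.
\<close>

definition proj_point :: "('i::finite \<Rightarrow> 'k::field) \<Rightarrow> ('i \<Rightarrow> 'k) set" where
  "proj_point p = {(\<lambda>i. c * p i) | c. c \<noteq> 0}"

definition proj_space :: "('i::finite \<Rightarrow> 'k::field) set set" where
  "proj_space = {proj_point p | p. p \<noteq> (\<lambda>i. 0)}"

text \<open>
  The index \<open>(X, i)\<close> stands for the coordinate \<open>x\<^sub>i\<close> and \<open>(Y, i)\<close> for \<open>y\<^sub>i\<close>, so \<open>row \<times> 'n\<close>
  indexes the entries of the \<open>2 \<times> V\<close> matrix and has \<open>2 V\<close> elements.  The type \<open>row\<close> itself indexes
  the two homogeneous coordinates of the projective line.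
\<close>

datatype row = X | Y

instance row :: finite
proof
  have "(UNIV :: row set) = {X, Y}"
    using row.exhaust by auto
  then show "finite (UNIV :: row set)"
    by (metis finite.emptyI finite_insert)
qed

text \<open>
  The class of \<open>s\<close> and the class of \<open>a\<close> are sent to the class of \<open>(s\<^sub>X a, s\<^sub>Y a)\<close>; all choices of
  representatives together make up exactly that class.
\<close>

definition segre_embedding ::
    "(row \<Rightarrow> 'k::field) set \<Rightarrow> ('n::finite \<Rightarrow> 'k) set \<Rightarrow> (row \<times> 'n \<Rightarrow> 'k) set" where
  "segre_embedding P Q = {(\<lambda>(r, i). s r * a i) | s a. s \<in> P \<and> a \<in> Q}"

definition segre_variety :: "(row \<times> 'n::finite \<Rightarrow> 'k::field) set set" where
  "segre_variety = {segre_embedding P Q | P Q. P \<in> proj_space \<and> Q \<in> proj_space}"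


section \<open>Polynomials and the Segre ideal\<close>

text \<open>
  A polynomial with variables indexed by \<open>'i\<close> is a finitely supported map from monomials, i.e. from
  finitely supported exponent maps, to coefficients.
\<close>

type_synonym ('i, 'k) mpoly = "('i \<Rightarrow>\<^sub>0 nat) \<Rightarrow>\<^sub>0 'k"

definition var :: "'i \<Rightarrow> ('i, 'k::comm_ring_1) mpoly" where
  "var i = Poly_Mapping.single (Poly_Mapping.single i 1) 1"

definition mpoly_eval :: "('i, 'k::comm_ring_1) mpoly \<Rightarrow> ('i \<Rightarrow> 'k) \<Rightarrow> 'k" where
  "mpoly_eval f p = (\<Sum>m\<in>Poly_Mapping.keys f. Poly_Mapping.lookup f m *
     (\<Prod>i\<in>Poly_Mapping.keys m. p i ^ Poly_Mapping.lookup m i))"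

text \<open>Ideals are the submodules of a commutative ring regarded as a module over itself.\<close>

definition ideal_generated :: "'r::comm_ring_1 set \<Rightarrow> 'r set" where
  "ideal_generated B = module.span (*) B"

definition segre_minor :: "'n::finite \<Rightarrow> 'n \<Rightarrow> (row \<times> 'n, 'k::field) mpoly" where
  "segre_minor i j = var (X, i) * var (Y, j) - var (X, j) * var (Y, i)"

definition segre_ideal :: "(row \<times> 'n::finite, 'k::field) mpoly set" where
  "segre_ideal = ideal_generated {segre_minor i j | i j. i \<noteq> j}"


section \<open>The point attached to a phase vector\<close>

text \<open>
  The ground field is any field \<open>'k\<close> containing the reals, in particular the real or the complex
  numbers.
\<close>

definition kuramoto_point :: "('n::finite \<Rightarrow> real) \<Rightarrow> row \<times> 'n \<Rightarrow> 'k::real_field" where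
  "kuramoto_point \<theta> = (\<lambda>(r, i). case r of X \<Rightarrow> of_real (sin (\<theta> i)) | Y \<Rightarrow> of_real (cos (\<theta> i)))"

end

theory Submission
  imports Defs
begin

text \<open>
  In a standard solution all phases agree up to multiples of \<open>\<pi>\<close>, so relative to one reference
  index \<open>k\<close> the vector \<open>(sin (\<theta> i), cos (\<theta> i))\<close> is \<open>\<plusminus> (sin (\<theta> k), cos (\<theta> k))\<close>, with the sign
  \<open>cos (\<theta> i - \<theta> k)\<close> (\<open>standard_solution_sin_cos\<close>).  The \<open>2 \<times> V\<close> matrix of the point
  therefore has rank one: it is the outer product of \<open>(sin (\<theta> k), cos (\<theta> k))\<close>, which is nonzero as
  it lies on the unit circle, and the vector of signs.  Hence its class is the image of a pair of
  projective points under the Segre embedding (\<open>segre_embedding_proj_point\<close>).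

  The minors vanish on every outer product.  Since evaluation at a point is a ring homomorphism
  (\<open>mpoly_eval_add\<close>, \<open>mpoly_eval_mult\<close>), the polynomials vanishing at a point form an ideal, so
  the whole ideal generated by the minors vanishes too (\<open>mpoly_eval_segre_ideal\<close>).
\<close>

definition monom_eval :: "('i \<Rightarrow>\<^sub>0 nat) \<Rightarrow> ('i \<Rightarrow> 'k::comm_ring_1) \<Rightarrow> 'k" where
  "monom_eval m p = (\<Prod>i\<in>Poly_Mapping.keys m. p i ^ Poly_Mapping.lookup m i)"

lemma monom_eval_superset:
  assumes "finite S" "Poly_Mapping.keys m \<subseteq> S"
  shows "monom_eval m p = (\<Prod>i\<in>S. p i ^ Poly_Mapping.lookup m i)"
  unfolding monom_eval_def
  by (rule prod.mono_neutral_left) (use assms in \<open>auto simp: in_keys_iff\<close>)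

lemma monom_eval_add: "monom_eval (m + n) p = monom_eval m p * monom_eval n p"
proof -
  let ?S = "Poly_Mapping.keys m \<union> Poly_Mapping.keys n"
  have "monom_eval (m + n) p = (\<Prod>i\<in>?S. p i ^ Poly_Mapping.lookup (m + n) i)"
    by (rule monom_eval_superset) (auto simp: in_keys_iff lookup_add)
  also have "\<dots> = (\<Prod>i\<in>?S. p i ^ Poly_Mapping.lookup m i) * (\<Prod>i\<in>?S. p i ^ Poly_Mapping.lookup n i)"
    by (simp add: lookup_add power_add prod.distrib)
  also have "\<dots> = monom_eval m p * monom_eval n p"
    by (simp add: monom_eval_superset [of ?S])
  finally show ?thesis .
qed

lemma mpoly_eval_superset:
  assumes "finite S" "Poly_Mapping.keys f \<subseteq> S"
  shows "mpoly_eval f p = (\<Sum>m\<in>S. Poly_Mapping.lookup f m * monom_eval m p)"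
  unfolding mpoly_eval_def monom_eval_def
  by (rule sum.mono_neutral_left) (use assms in \<open>auto simp: in_keys_iff\<close>)

lemma mpoly_eval_zero: "mpoly_eval 0 p = 0"
  by (simp add: mpoly_eval_def)

lemma mpoly_eval_add: "mpoly_eval (f + g) p = mpoly_eval f p + mpoly_eval g p"
proof -
  let ?S = "Poly_Mapping.keys f \<union> Poly_Mapping.keys g"
  have "mpoly_eval (f + g) p = (\<Sum>m\<in>?S. Poly_Mapping.lookup (f + g) m * monom_eval m p)"
    by (rule mpoly_eval_superset) (auto simp: in_keys_iff lookup_add)
  also have "\<dots> = mpoly_eval f p + mpoly_eval g p"
    by (simp add: mpoly_eval_superset [of ?S] lookup_add distrib_right sum.distrib)
  finally show ?thesis .
qed

lemma mpoly_eval_diff: "mpoly_eval (f - g) p = mpoly_eval f p - mpoly_eval g p"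
  using mpoly_eval_add [of "f - g" g p] by simp

lemma mpoly_eval_single: "mpoly_eval (Poly_Mapping.single m c) p = c * monom_eval m p"
  by (simp add: mpoly_eval_superset [of "{m}"])

lemma mpoly_eval_sum: "mpoly_eval (sum h A) p = (\<Sum>a\<in>A. mpoly_eval (h a) p)"
  by (induction A rule: infinite_finite_induct) (simp_all add: mpoly_eval_zero mpoly_eval_add)

lemma poly_mapping_eq_sum_single:
  "h = (\<Sum>m\<in>Poly_Mapping.keys h. Poly_Mapping.single m (Poly_Mapping.lookup h m))"
  by (rule poly_mapping_eqI) (simp add: lookup_sum lookup_single when_def in_keys_iff)

text \<open>
  By bilinearity the claim reduces to single terms, whose products are governed by
  \<open>monom_eval_add\<close>.
\<close>

lemma mpoly_eval_mult: "mpoly_eval (f * g) p = mpoly_eval f p * mpoly_eval g p"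
proof -
  let ?t = "\<lambda>h m. Poly_Mapping.single m (Poly_Mapping.lookup h m)"
  have "f * g = (\<Sum>m\<in>Poly_Mapping.keys f. \<Sum>n\<in>Poly_Mapping.keys g. ?t f m * ?t g n)"
    by (subst poly_mapping_eq_sum_single [of f], subst poly_mapping_eq_sum_single [of g]) (simp add: sum_product)
  then have "mpoly_eval (f * g) p =
      (\<Sum>m\<in>Poly_Mapping.keys f. \<Sum>n\<in>Poly_Mapping.keys g.
        mpoly_eval (?t f m) p * mpoly_eval (?t g n) p)"
    by (simp add: mpoly_eval_sum mpoly_eval_single mult_single monom_eval_add mult_ac)
  also have "\<dots> = mpoly_eval f p * mpoly_eval g p"
    by (simp add: sum_product mpoly_eval_single
        mpoly_eval_superset [of "Poly_Mapping.keys f" f]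
        mpoly_eval_superset [of "Poly_Mapping.keys g" g])
  finally show ?thesis .
qed

lemma mpoly_eval_var: "mpoly_eval (var i) p = p i"
  by (simp add: var_def mpoly_eval_single monom_eval_def)

text \<open>
  The polynomials vanishing at \<open>p\<close> are closed under addition and under multiplication by arbitrary
  polynomials; this is where multiplicativity of evaluation enters.
\<close>

lemma mpoly_eval_ideal_generated:
  assumes "f \<in> ideal_generated B" and "\<And>b. b \<in> B \<Longrightarrow> mpoly_eval b p = 0"
  shows "mpoly_eval f p = 0"
proof -
  interpret module "(*) :: ('a, 'b) mpoly \<Rightarrow> ('a, 'b) mpoly \<Rightarrow> ('a, 'b) mpoly"
    by unfold_locales (simp_all add: algebra_simps)
  have "subspace {f. mpoly_eval f p = 0}"
    by (rule subspaceI) (simp_all add: mpoly_eval_zero mpoly_eval_add mpoly_eval_mult)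
  with assms show ?thesis
    unfolding ideal_generated_def by (auto dest: span_induct)
qed

lemma mpoly_eval_segre_ideal:
  assumes "f \<in> segre_ideal"
  shows "mpoly_eval f (\<lambda>(r, i). s r * a i) = 0"
  using assms unfolding segre_ideal_def
  by (rule mpoly_eval_ideal_generated)
    (auto simp: segre_minor_def mpoly_eval_diff mpoly_eval_mult mpoly_eval_var)

lemma segre_embedding_proj_point:
  "segre_embedding (proj_point s) (proj_point a) = proj_point (\<lambda>(r, i). s r * a i)"
proof (intro set_eqI iffI)
  fix q assume "q \<in> segre_embedding (proj_point s) (proj_point a)"
  then obtain c d where "c \<noteq> 0" "d \<noteq> 0" "q = (\<lambda>(r, i). (c * s r) * (d * a i))"
    by (auto simp: segre_embedding_def proj_point_def)
  then show "q \<in> proj_point (\<lambda>(r, i). s r * a i)"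
    unfolding proj_point_def by (auto intro!: exI [of _ "c * d"] simp: fun_eq_iff)
next
  fix q assume "q \<in> proj_point (\<lambda>(r, i). s r * a i)"
  then obtain c where c: "c \<noteq> 0" "q = (\<lambda>(r, i). (c * s r) * a i)"
    by (auto simp: proj_point_def fun_eq_iff)
  have "(\<lambda>r. c * s r) \<in> proj_point s"
    using c(1) by (auto simp: proj_point_def)
  moreover have "a \<in> proj_point a"
    by (auto simp: proj_point_def intro!: exI [of _ 1])
  ultimately show "q \<in> segre_embedding (proj_point s) (proj_point a)"
    unfolding segre_embedding_def c(2)
    by (intro CollectI exI [of _ "\<lambda>r. c * s r"] exI [of _ a]) simp
qed

text \<open>
  Expanding \<open>\<theta> i = (\<theta> i - \<theta> k) + \<theta> k\<close> by the addition formulas, the terms containing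
  \<open>sin (\<theta> i - \<theta> k)\<close> drop out, since the phase difference is a multiple of \<open>\<pi>\<close>.
\<close>

lemma standard_solution_sin_cos:
  assumes "standard_solution G v \<theta>"
  shows "sin (\<theta> i) = cos (\<theta> i - \<theta> k) * sin (\<theta> k)"
    and "cos (\<theta> i) = cos (\<theta> i - \<theta> k) * cos (\<theta> k)"
proof -
  have "[\<theta> i - \<theta> k = 0] (rmod (2 * pi)) \<or> [\<theta> i - \<theta> k = pi] (rmod (2 * pi))"
    using assms by (simp add: standard_solution_def)
  then obtain n :: int where
    "\<theta> i - \<theta> k = of_int (- 2 * n) * pi \<or> \<theta> i - \<theta> k = of_int (1 - 2 * n) * pi"
    unfolding rcong_altdef by (force simp: algebra_simps)
  then have "sin (\<theta> i - \<theta> k) = 0"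
    unfolding sin_zero_iff_int2 by blast
  then show "sin (\<theta> i) = cos (\<theta> i - \<theta> k) * sin (\<theta> k)"
    and "cos (\<theta> i) = cos (\<theta> i - \<theta> k) * cos (\<theta> k)"
    using sin_add [of "\<theta> i - \<theta> k" "\<theta> k"] cos_add [of "\<theta> i - \<theta> k" "\<theta> k"] by simp_all
qed

theorem mainTheorem4:
  fixes G :: "('a, 'e) pre_digraph"
    and v :: "'n::finite \<Rightarrow> 'a"
    and \<theta> :: "'n \<Rightarrow> real"
  assumes "sct_graph G"
    and "vertex_labelling G v"
    and "standard_solution G v \<theta>"
  shows "proj_point (kuramoto_point \<theta> :: row \<times> 'n \<Rightarrow> 'k::real_field) \<in> segre_variety \<and>
    (\<forall>f \<in> (segre_ideal :: (row \<times> 'n, 'k) mpoly set). mpoly_eval f (kuramoto_point \<theta>) = 0)"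
proof -
  obtain k :: 'n where True by simp
  define s :: "row \<Rightarrow> 'k" where
    "s = (\<lambda>r. case r of X \<Rightarrow> of_real (sin (\<theta> k)) | Y \<Rightarrow> of_real (cos (\<theta> k)))"
  define a :: "'n \<Rightarrow> 'k" where "a = (\<lambda>i. of_real (cos (\<theta> i - \<theta> k)))"
  have outer: "kuramoto_point \<theta> = (\<lambda>(r, i). s r * a i)"
  proof (rule ext, clarify)
    fix r i
    show "kuramoto_point \<theta> (r, i) = s r * a i"
      using standard_solution_sin_cos [OF assms(3), of i k]
      by (cases r) (simp_all add: kuramoto_point_def s_def a_def mult.commute flip: of_real_mult)
  qed
  have "s X \<noteq> 0 \<or> s Y \<noteq> 0"
    using sin_zero_abs_cos_one [of "\<theta> k"] by (auto simp: s_def)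
  then have "s \<noteq> (\<lambda>r. 0)" by auto
  moreover have "a k = 1" by (simp add: a_def)
  then have "a \<noteq> (\<lambda>i. 0)" by auto
  ultimately have "proj_point (kuramoto_point \<theta> :: row \<times> 'n \<Rightarrow> 'k) \<in> segre_variety"
    unfolding outer segre_embedding_proj_point [symmetric] segre_variety_def proj_space_def
    by blast
  then show ?thesis
    by (simp add: outer mpoly_eval_segre_ideal)
qed

end
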